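(* Let $R$ be an associative ring (not necessarily with identity). The following conditions are equivalent. (1) Every right strongly $\pi$-regular element of $R$ is strongly $\pi$-regular. (2) Every right strongly regular element of $R$ is strongly regular.
   Context: Let $R$ be an associative ring, not necessarily with identity, and $a\in R$. The element $a$ is right strongly $\pi$-regular if there exist $x\in R$ and an integer $n\ge 1$ with $a^n=a^{n+1}x$; it is left strongly $\pi$-regular if there exist $y\in R$ and an integer $m\ge 1$ with $a^m=ya^{m+1}$; it is strongly $\pi$-regular if it is both left and right strongly $\pi$-regular. The element $a$ is right strongly regular if $a=a^2x$ for some $x\in R$; left strongly regular if $a=ya^2$ for some $y\in R$; strongly regular if it is both left and right strongly regular. *)

theory Defs
  imports Main
begin

text \<open>
  The type class \<open>ring\<close> describes associative rings that need not have an identity. The library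
  power operation requires an identity element, so positive powers are defined here directly.
  The value at exponent \<open>0\<close> is a dummy; every exponent below is constrained to be at least \<open>1\<close>.
\<close>

fun ring_pow :: "'a::ring \<Rightarrow> nat \<Rightarrow> 'a" where
  "ring_pow a 0 = 0"
| "ring_pow a (Suc 0) = a"
| "ring_pow a (Suc (Suc n)) = ring_pow a (Suc n) * a"

lemma ring_pow_eq_power:
  fixes a :: "'a::ring_1"
  assumes "n \<ge> 1"
  shows "ring_pow a n = a ^ n"
  using assms by (induction a n rule: ring_pow.induct) (simp_all add: power_commutes mult.assoc)

definition right_strongly_pi_regular :: "'a::ring \<Rightarrow> bool" where
  "right_strongly_pi_regular a \<longleftrightarrow>
     (\<exists>x. \<exists>n::nat. n \<ge> 1 \<and> ring_pow a n = ring_pow a (n + 1) * x)"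

definition left_strongly_pi_regular :: "'a::ring \<Rightarrow> bool" where
  "left_strongly_pi_regular a \<longleftrightarrow>
     (\<exists>y. \<exists>m::nat. m \<ge> 1 \<and> ring_pow a m = y * ring_pow a (m + 1))"

definition strongly_pi_regular :: "'a::ring \<Rightarrow> bool" where
  "strongly_pi_regular a \<longleftrightarrow> left_strongly_pi_regular a \<and> right_strongly_pi_regular a"

definition right_strongly_regular :: "'a::ring \<Rightarrow> bool" where
  "right_strongly_regular a \<longleftrightarrow> (\<exists>x. a = ring_pow a 2 * x)"

definition left_strongly_regular :: "'a::ring \<Rightarrow> bool" where
  "left_strongly_regular a \<longleftrightarrow> (\<exists>y. a = y * ring_pow a 2)"

definition strongly_regular :: "'a::ring \<Rightarrow> bool" where
  "strongly_regular a \<longleftrightarrow> left_strongly_regular a \<and> right_strongly_regular a"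

end

theory Submission
  imports Defs
begin

text \<open>
  The equation \<open>a\<^sup>n = a\<^sup>n\<^sup>+\<^sup>1 x\<close> can be substituted into itself, which gives
  \<open>a\<^sup>n = a\<^sup>n\<^sup>+\<^sup>k x\<^sup>k\<close> for every \<open>k \<ge> 1\<close> (\<open>ring_pow_absorb_right\<close>). Both implications are
  choices of \<open>k\<close>.

  If right strongly regular elements are strongly regular and \<open>a\<^sup>n = a\<^sup>n\<^sup>+\<^sup>1 x\<close>, take \<open>k = n\<close>:
  the power \<open>a\<^sup>n = (a\<^sup>n)\<^sup>2 x\<^sup>n\<close> is right strongly regular, hence left strongly regular, and a left
  strongly regular power makes \<open>a\<close> left strongly \<open>\<pi>\<close>-regular.

  Conversely, let \<open>a = a\<^sup>2 x\<close>, so that \<open>a\<close> is right strongly \<open>\<pi>\<close>-regular with exponent \<open>1\<close>, and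
  let \<open>a\<^sup>m = y a\<^sup>m\<^sup>+\<^sup>1\<close> be the left equation that is then available. With \<open>k = m\<close>, the element \<open>a\<close>
  is a right multiple of \<open>a\<^sup>m\<close>, so the left equation descends from \<open>a\<^sup>m\<close> to \<open>a\<close>:
  \<open>a = a\<^sup>m\<^sup>+\<^sup>1 x\<^sup>m = y a (a\<^sup>m\<^sup>+\<^sup>1 x\<^sup>m) = y a\<^sup>2\<close>.
\<close>

lemma ring_pow_two: "ring_pow (a::'a::ring) 2 = a * a"
  by (simp add: numeral_2_eq_2)

lemma ring_pow_Suc_right:
  fixes a :: "'a::ring"
  assumes "n \<ge> 1"
  shows "ring_pow a (Suc n) = ring_pow a n * a"
  using assms by (cases n) simp_all

lemma ring_pow_add:
  fixes a :: "'a::ring"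
  assumes "m \<ge> 1" "n \<ge> 1"
  shows "ring_pow a (m + n) = ring_pow a m * ring_pow a n"
  using assms(2)
proof (induction n rule: dec_induct)
  case base
  show ?case using ring_pow_Suc_right[OF assms(1)] by simp
next
  case (step n)
  then show ?case
    using ring_pow_Suc_right[of n a] ring_pow_Suc_right[of "m + n" a]
    by (simp add: mult.assoc)
qed

text \<open>
  Each step replaces \<open>a\<^sup>n\<close> by \<open>a\<^sup>n\<^sup>+\<^sup>1 x\<close> on the right of \<open>a\<^sup>n\<^sup>+\<^sup>k = a\<^sup>k a\<^sup>n\<close>. The new factor \<open>x\<close>
  then stands directly before \<open>x\<^sup>k\<close>, so \<open>a\<close> and \<open>x\<close> never have to be interchanged.
\<close>

lemma ring_pow_absorb_right:
  fixes a x :: "'a::ring"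
  assumes "n \<ge> 1" and eq: "ring_pow a n = ring_pow a (n + 1) * x" and "k \<ge> 1"
  shows "ring_pow a n = ring_pow a (n + k) * ring_pow x k"
  using assms(3)
proof (induction k rule: dec_induct)
  case base
  show ?case using eq by simp
next
  case (step k)
  have "ring_pow a (n + k) = ring_pow a k * ring_pow a n"
    using ring_pow_add[of k n a] step.hyps assms(1) by (simp add: add.commute)
  also have "\<dots> = ring_pow a k * ring_pow a (n + 1) * x"
    by (subst eq) (simp add: mult.assoc)
  also have "\<dots> = ring_pow a (n + Suc k) * x"
    using ring_pow_add[of k "n + 1" a] step.hyps by (simp add: add.commute)
  finally have "ring_pow a n = ring_pow a (n + Suc k) * x * ring_pow x k"
    using step.IH by simp
  moreover have "ring_pow x (Suc k) = x * ring_pow x k"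
    using ring_pow_add[of 1 k x] step.hyps by simp
  ultimately show ?case by (simp add: mult.assoc)
qed

lemma right_strongly_regular_imp_pi_regular:
  fixes a :: "'a::ring"
  assumes "right_strongly_regular a"
  shows "right_strongly_pi_regular a"
proof -
  obtain x where "a = ring_pow a 2 * x"
    using assms unfolding right_strongly_regular_def by blast
  then have "ring_pow a 1 = ring_pow a (1 + 1) * x"
    by (simp add: numeral_2_eq_2)
  then show ?thesis
    unfolding right_strongly_pi_regular_def by blast
qed

lemma right_strongly_pi_regular_power:
  fixes a :: "'a::ring"
  assumes "right_strongly_pi_regular a"
  obtains n where "n \<ge> 1" "right_strongly_regular (ring_pow a n)"
proof -
  obtain x n where n: "n \<ge> 1" and eq: "ring_pow a n = ring_pow a (n + 1) * x"
    using assms unfolding right_strongly_pi_regular_def by blast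
  have "ring_pow a n = ring_pow a (n + n) * ring_pow x n"
    using ring_pow_absorb_right[OF n eq n] .
  then have "right_strongly_regular (ring_pow a n)"
    unfolding right_strongly_regular_def using ring_pow_add[OF n n, of a]
    by (auto simp: ring_pow_two)
  with n show ?thesis by (rule that)
qed

lemma left_strongly_pi_regular_if_power:
  fixes a :: "'a::ring"
  assumes n: "n \<ge> 1" and "left_strongly_regular (ring_pow a n)"
  shows "left_strongly_pi_regular a"
proof -
  obtain y where y: "ring_pow a n = y * ring_pow a (n + n)"
    using assms ring_pow_add[OF n n, of a]
    unfolding left_strongly_regular_def by (auto simp: ring_pow_two)
  \<comment> \<open>The surplus factor \<open>a\<^sup>n\<^sup>-\<^sup>1\<close> of \<open>a\<^sup>2\<^sup>n\<close> is moved into the coefficient. For \<open>n = 1\<close> there is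
    no surplus, and without an identity \<open>a\<^sup>0\<close> cannot stand in for it.\<close>
  have "\<exists>z. ring_pow a n = z * ring_pow a (n + 1)"
  proof (cases "n = 1")
    case True
    then show ?thesis using y by auto
  next
    case False
    then have "ring_pow a (n + n) = ring_pow a (n - 1) * ring_pow a (n + 1)"
      using ring_pow_add[of "n - 1" "n + 1" a] n by simp
    then have "ring_pow a n = (y * ring_pow a (n - 1)) * ring_pow a (n + 1)"
      using y by (simp add: mult.assoc)
    then show ?thesis by blast
  qed
  with n show ?thesis unfolding left_strongly_pi_regular_def by blast
qed

text \<open>
  Right strong regularity makes \<open>a\<close> a right multiple of each of its powers, so a left equation
  for any power of \<open>a\<close> already holds for \<open>a\<close> itself.
\<close>

lemma left_strongly_regular_if_right_and_left_pi:
  fixes a :: "'a::ring"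
  assumes "right_strongly_regular a" "left_strongly_pi_regular a"
  shows "left_strongly_regular a"
proof -
  obtain x where "a = ring_pow a 2 * x"
    using assms(1) unfolding right_strongly_regular_def by blast
  then have x: "ring_pow a 1 = ring_pow a (1 + 1) * x"
    by (simp add: numeral_2_eq_2)
  obtain y m where m: "m \<ge> 1" and y: "ring_pow a m = y * ring_pow a (m + 1)"
    using assms(2) unfolding left_strongly_pi_regular_def by blast
  have a: "a = ring_pow a (m + 1) * ring_pow x m"
    using ring_pow_absorb_right[OF _ x m] by (simp add: add.commute)
  have "ring_pow a (m + 1) = ring_pow a m * a"
    using ring_pow_Suc_right[OF m] by simp
  also have "\<dots> = y * (ring_pow a (m + 1) * a)"
    by (subst y) (simp add: mult.assoc)
  also have "ring_pow a (m + 1) * a = a * ring_pow a (m + 1)"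
    using ring_pow_add[of "m + 1" 1 a] ring_pow_add[of 1 "m + 1" a] by simp
  finally have "ring_pow a (m + 1) * ring_pow x m
      = y * (a * ring_pow a (m + 1)) * ring_pow x m"
    by (rule arg_cong)
  then have "ring_pow a (m + 1) * ring_pow x m
      = y * a * (ring_pow a (m + 1) * ring_pow x m)"
    by (simp only: mult.assoc)
  then have "a = y * ring_pow a 2"
    using a by (simp add: ring_pow_two mult.assoc)
  then show ?thesis unfolding left_strongly_regular_def by blast
qed

theorem proposition1p1:
  shows "(\<forall>a::'a::ring. right_strongly_pi_regular a \<longrightarrow> strongly_pi_regular a) \<longleftrightarrow>
         (\<forall>a::'a. right_strongly_regular a \<longrightarrow> strongly_regular a)"
proof (intro iffI allI impI)
  fix a :: 'a
  assume "\<forall>a::'a. right_strongly_pi_regular a \<longrightarrow> strongly_pi_regular a"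
    and a: "right_strongly_regular a"
  then have "left_strongly_pi_regular a"
    using right_strongly_regular_imp_pi_regular unfolding strongly_pi_regular_def by blast
  with a show "strongly_regular a"
    using left_strongly_regular_if_right_and_left_pi unfolding strongly_regular_def by blast
next
  fix a :: 'a
  assume regular: "\<forall>a::'a. right_strongly_regular a \<longrightarrow> strongly_regular a"
    and a: "right_strongly_pi_regular a"
  obtain n where n: "n \<ge> 1" "right_strongly_regular (ring_pow a n)"
    using right_strongly_pi_regular_power[OF a] .
  then have "left_strongly_regular (ring_pow a n)"
    using regular unfolding strongly_regular_def by blast
  with n a show "strongly_pi_regular a"
    using left_strongly_pi_regular_if_power unfolding strongly_pi_regular_def by blast
qed

end
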